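(* Let $L\ge 1$, $N_s=2^L$, and let $H\in\mathbb{R}^{M\times N}$ be a real matrix partitioned into $2^L$ row blocks, $H^T=[H_1^T,\dots,H_{N_s}^T]$. Let $\hat H$ be an approximation of $H$ produced by the recursive low-rank procedure along a perfect binary tree of depth $L$ with relative tolerance $\epsilon\in(0,1]$ at every leaf compression and at every agglomeration step. (i) If all tolerances are measured in the norm $\|\cdot\|$, where $\|\cdot\|$ is the spectral norm or the Frobenius norm, then $$\|H-\hat H\|\le (L+1)\,\epsilon\sum_{b=1}^{N_s}\|H_b\|+O(\epsilon^2).$$ (ii) If all tolerances are measured in the Frobenius norm, then $$\|H-\hat H\|_F\le 2^{L/2}(L+1)\,\epsilon\,\|H\|_F+O(\epsilon^2),$$ and, with $N_r=\min\{M,N\}$, $$\|H-\hat H\|_2\le \sqrt{N_r}\;2^{L/2}(L+1)\,\epsilon\,\|H\|_2+O(\epsilon^2).$$ Here $O(\epsilon^2)$ denotes a quantity bounded by $C\epsilon^2$ for all $\epsilon\in(0,1]$, with $C$ depending only on $L$ and $H$ (not on $\epsilon$ or on the choices made in the procedure).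
   Context: Recursive low-rank procedure: consider a perfect binary tree of depth $L$ (root at level $0$, $2^L$ leaves at level $L$) whose leaves, from left to right, correspond to the blocks $H_1,\dots,H_{N_s}$. For each leaf $b$, a matrix $\hat H_b$ (a low-rank approximation) of the same size as $H_b$ is chosen with $\|H_b-\hat H_b\|\le\epsilon\|H_b\|$. For each non-leaf node $b$ with children $b_1,b_2$ (left, right), the already computed approximations are stacked and recompressed (agglomeration): a matrix $\hat H_b$ of the same size as the stacked matrix $\begin{bmatrix}\hat H_{b_1}\\ \hat H_{b_2}\end{bmatrix}$ is chosen with $$\left\|\hat H_b-\begin{bmatrix}\hat H_{b_1}\\ \hat H_{b_2}\end{bmatrix}\right\|\le\epsilon\left\|\begin{bmatrix}\hat H_{b_1}\\ \hat H_{b_2}\end{bmatrix}\right\|.$$ The output $\hat H$ is the matrix at the root. $\|\cdot\|_2$ is the spectral norm and $\|\cdot\|_F$ the Frobenius norm. *)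

theory Defs
  imports Complex_Main "Jordan_Normal_Form.Matrix"
begin

definition euclidean_norm :: "real vec \<Rightarrow> real" where
  "euclidean_norm v = sqrt (v \<bullet> v)"

text \<open>The operator norm induced by the Euclidean norms.  The supremum ranges over the closed unit
  ball, which is nonempty (and gives norm 0) even for a matrix without columns.\<close>

definition spectral_norm :: "real mat \<Rightarrow> real" where
  "spectral_norm A =
     (SUP v\<in>{v \<in> carrier_vec (dim_col A). euclidean_norm v \<le> 1}. euclidean_norm (A *\<^sub>v v))"

definition frobenius_norm :: "real mat \<Rightarrow> real" where
  "frobenius_norm A = sqrt (\<Sum>i<dim_row A. \<Sum>j<dim_col A. (A $$ (i, j))\<^sup>2)"

text \<open>\<open>Hs ! 0, Hs ! 1, \<dots>\<close> are consecutive row blocks of \<open>H\<close>, from top to bottom;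
  their heights may differ.\<close>

definition row_partition :: "real mat \<Rightarrow> real mat list \<Rightarrow> bool" where
  "row_partition H Hs \<longleftrightarrow>
     (\<forall>B \<in> set Hs. dim_col B = dim_col H) \<and> H = foldr (@\<^sub>r) Hs (0\<^sub>m 0 (dim_col H))"

text \<open>\<open>Hhat l b\<close> is the matrix chosen at the \<open>b\<close>-th node (from the left, counting from 0) of
  level \<open>l\<close> of the perfect binary tree.  The children of node \<open>(l, b)\<close> are the nodes
  \<open>(l + 1, 2 b)\<close> and \<open>(l + 1, 2 b + 1)\<close>, and the output of the procedure is \<open>Hhat 0 0\<close>.
  The sizes are prescribed explicitly because subtraction of matrices is total.  As only the
  tolerances matter, no bound on the ranks is imposed.\<close>

definition recursive_low_rank ::
  "(real mat \<Rightarrow> real) \<Rightarrow> real \<Rightarrow> nat \<Rightarrow> real mat list \<Rightarrow> (nat \<Rightarrow> nat \<Rightarrow> real mat) \<Rightarrow> bool" where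
  "recursive_low_rank nrm \<epsilon> L Hs Hhat \<longleftrightarrow>
     (\<forall>b < 2 ^ L.
        Hhat L b \<in> carrier_mat (dim_row (Hs ! b)) (dim_col (Hs ! b)) \<and>
        nrm (Hs ! b - Hhat L b) \<le> \<epsilon> * nrm (Hs ! b)) \<and>
     (\<forall>l < L. \<forall>b < 2 ^ l.
        let S = Hhat (Suc l) (2 * b) @\<^sub>r Hhat (Suc l) (2 * b + 1)
        in Hhat l b \<in> carrier_mat (dim_row S) (dim_col S) \<and>
           nrm (Hhat l b - S) \<le> \<epsilon> * nrm S)"

end

theory Submission
  imports Defs "HOL-Analysis.L2_Norm"
begin

text \<open>If the exact blocks below a node are stacked, the relative errors compound: an error factor
  \<open>(1 + \<epsilon>)^k - 1\<close> relative to the sum of the norms of the leaf blocks becomes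
  \<open>(1 + \<epsilon>)((1 + \<epsilon>)^k - 1) + \<epsilon> = (1 + \<epsilon>)^(k + 1) - 1\<close> after one agglomeration. A leaf has \<open>k = 1\<close>,
  so the root has \<open>k = L + 1\<close>. The Frobenius bounds follow by the Cauchy--Schwarz inequality over
  the \<open>2 ^ L\<close> leaves and the comparison of the Frobenius and spectral norms.\<close>

section \<open>Stacking matrices\<close>

lemma dim_append_rows [simp]:
  "dim_row (A @\<^sub>r B) = dim_row A + dim_row B" "dim_col (A @\<^sub>r B) = dim_col A"
  by (simp_all add: append_rows_def)

lemma index_append_rows:
  assumes "dim_col A = dim_col B" "i < dim_row A + dim_row B" "j < dim_col A"
  shows "(A @\<^sub>r B) $$ (i, j) =
    (if i < dim_row A then A $$ (i, j) else B $$ (i - dim_row A, j))"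
  using assms by (auto simp: append_rows_def)

lemma append_rows_assoc:
  assumes "dim_col A = dim_col B" "dim_col B = dim_col C"
  shows "(A @\<^sub>r B) @\<^sub>r C = A @\<^sub>r (B @\<^sub>r C)"
  by (rule eq_matI) (use assms in \<open>auto simp: index_append_rows\<close>)

lemma append_rows_empty:
  assumes "dim_col A = n"
  shows "0\<^sub>m 0 n @\<^sub>r A = A" "A @\<^sub>r 0\<^sub>m 0 n = A"
  by (rule eq_matI; use assms in \<open>simp add: index_append_rows\<close>)+

lemma append_rows_minus:
  assumes "dim_col A = dim_col B" "A' \<in> carrier_mat (dim_row A) (dim_col A)"
    "B' \<in> carrier_mat (dim_row B) (dim_col B)"
  shows "(A @\<^sub>r B) - (A' @\<^sub>r B') = (A - A') @\<^sub>r (B - B')"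
  by (rule eq_matI) (use assms in \<open>auto simp: index_append_rows\<close>)

text \<open>The fold of \<open>row_partition\<close>. Carrying \<open>n\<close> gives the empty
  stack \<open>n\<close> columns, so that it is neutral for matrices with \<open>n\<close>
  columns.\<close>

abbreviation stack :: "nat \<Rightarrow> real mat list \<Rightarrow> real mat" where
  "stack n Bs \<equiv> foldr (@\<^sub>r) Bs (0\<^sub>m 0 n)"

lemma dim_col_stack:
  "(\<And>B. B \<in> set Bs \<Longrightarrow> dim_col B = n) \<Longrightarrow> dim_col (stack n Bs) = n"
  by (cases Bs) auto

lemma stack_append:
  assumes "\<And>B. B \<in> set (Bs @ Cs) \<Longrightarrow> dim_col B = n"
  shows "stack n (Bs @ Cs) = stack n Bs @\<^sub>r stack n Cs"
  using assms
proof (induction Bs)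
  case Nil
  then have "dim_col (stack n Cs) = n" by (intro dim_col_stack) auto
  then show ?case by (simp add: append_rows_empty)
next
  case (Cons A Bs)
  have "dim_col (stack n Bs) = n" "dim_col (stack n Cs) = n"
    using Cons.prems by (auto intro!: dim_col_stack)
  with Cons show ?case by (simp add: append_rows_assoc)
qed

section \<open>Error propagation along the tree\<close>

text \<open>Turns a compound factor into its first-order part plus an explicit quadratic remainder.
  The constant \<open>3 ^ n\<close> is crude, but it depends only on \<open>n\<close> and is
  preserved by the induction.\<close>

lemma power_one_plus_le:
  fixes x :: real
  assumes "0 \<le> x" "x \<le> 1"
  shows "(1 + x) ^ n - 1 \<le> real n * x + 3 ^ n * x\<^sup>2"
proof (induction n)
  case (Suc n)
  have n: "real n \<le> 3 ^ n"
    using Bernoulli_inequality[of 2 n] by simp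
  have "(1 + x) ^ Suc n \<le> (1 + x) * (1 + real n * x + 3 ^ n * x\<^sup>2)"
    using Suc assms by (simp add: mult_left_mono)
  \<comment> \<open>The extra factor adds \<open>real n\<close> (from
    \<open>x * (real n * x)\<close>) and \<open>3 ^ n * x\<close> to the quadratic coefficient. For
    \<open>x \<le> 1\<close> each of the three summands is at most \<open>3 ^ n\<close>; hence the
    base 3.\<close>
  also have "\<dots> = 1 + real (Suc n) * x + (real n + 3 ^ n + 3 ^ n * x) * x\<^sup>2"
    by (simp add: algebra_simps power2_eq_square)
  also have "\<dots> \<le> 1 + real (Suc n) * x + 3 ^ Suc n * x\<^sup>2"
  proof -
    have "3 ^ n * x \<le> (3 ^ n :: real)" using assms mult_left_mono[of x 1 "3 ^ n"] by simp
    with n have "real n + 3 ^ n + 3 ^ n * x \<le> 3 ^ Suc n" unfolding power_Suc by linarith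
    then show ?thesis by (intro add_left_mono mult_right_mono) auto
  qed
  finally show ?case by simp
qed simp

text \<open>The properties of a norm that the error propagation uses, so that one argument serves
  both norms. Of homogeneity only \<open>minus_commute\<close> is kept. The laws carry dimension
  premises because matrix operations are total.\<close>

locale stacking_norm =
  fixes nrm :: "real mat \<Rightarrow> real"
  assumes nonneg: "0 \<le> nrm A"
    and triangle: "\<lbrakk>A \<in> carrier_mat m n; B \<in> carrier_mat m n\<rbrakk> \<Longrightarrow> nrm (A + B) \<le> nrm A + nrm B"
    and minus_commute: "\<lbrakk>A \<in> carrier_mat m n; B \<in> carrier_mat m n\<rbrakk> \<Longrightarrow> nrm (A - B) = nrm (B - A)"
    and append: "dim_col A = dim_col B \<Longrightarrow> nrm (A @\<^sub>r B) \<le> nrm A + nrm B"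
    and le_append1: "dim_col A = dim_col B \<Longrightarrow> nrm A \<le> nrm (A @\<^sub>r B)"
    and le_append2: "dim_col A = dim_col B \<Longrightarrow> nrm B \<le> nrm (A @\<^sub>r B)"
begin

lemma diff_triangle:
  assumes "A \<in> carrier_mat m n" "B \<in> carrier_mat m n" "C \<in> carrier_mat m n"
  shows "nrm (A - C) \<le> nrm (A - B) + nrm (B - C)"
proof -
  have "A - C = (A - B) + (B - C)"
    by (rule eq_matI) (use assms in auto)
  then show ?thesis
    using triangle[of "A - B" m n "B - C"] assms by (simp add: minus_carrier_mat)
qed

text \<open>Controls a computed matrix \<open>B\<close> by the exact matrix \<open>A\<close>: the
  tolerance of an agglomeration is relative to the computed stack, while the final bounds refer to
  exact blocks.\<close>

lemma le_diff_add:
  assumes "A \<in> carrier_mat m n" "B \<in> carrier_mat m n"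
  shows "nrm B \<le> nrm (A - B) + nrm A"
proof -
  have "B = (B - A) + A"
    by (rule eq_matI) (use assms in auto)
  then show ?thesis
    using triangle[of "B - A" m n A] assms minus_commute[of A m n B]
    by (simp add: minus_carrier_mat)
qed

text \<open>Keeps the remainder constant independent of the partition: whatever the blocks are, each
  is dominated by the norm of the whole matrix.\<close>

lemma block_le_stack:
  assumes "\<And>B. B \<in> set Bs \<Longrightarrow> dim_col B = n" "B \<in> set Bs"
  shows "nrm B \<le> nrm (stack n Bs)"
  using assms
proof (induction Bs)
  case (Cons A Bs)
  have "dim_col A = n" "dim_col (stack n Bs) = n"
    using Cons.prems by (auto intro!: dim_col_stack)
  then have "nrm A \<le> nrm (stack n (A # Bs))" "nrm (stack n Bs) \<le> nrm (stack n (A # Bs))"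
    using le_append1[of A "stack n Bs"] le_append2[of A "stack n Bs"] by simp_all
  moreover have "nrm B \<le> nrm (stack n Bs)" if "B \<in> set Bs"
    using Cons.IH Cons.prems that by simp
  ultimately show ?case using Cons.prems(2) by fastforce
qed simp

text \<open>The children's errors add up to at most \<open>(q - 1) * (x + y)\<close>, so the
  computed stack has norm at most \<open>q * (x + y)\<close>, and recompression costs at most
  \<epsilon> times that. The bounds \<open>x\<close> and \<open>y\<close> stand for sums of leaf
  norms, which simply add from level to level.\<close>

lemma agglomeration_error:
  assumes dims: "dim_col A = dim_col B" "A' \<in> carrier_mat (dim_row A) (dim_col A)"
      "B' \<in> carrier_mat (dim_row B) (dim_col B)" "C \<in> carrier_mat (dim_row (A' @\<^sub>r B')) (dim_col (A' @\<^sub>r B'))"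
    and eps: "0 \<le> \<epsilon>" and C: "nrm (C - (A' @\<^sub>r B')) \<le> \<epsilon> * nrm (A' @\<^sub>r B')"
    and A: "nrm A \<le> x" "nrm (A - A') \<le> (q - 1) * x"
    and B: "nrm B \<le> y" "nrm (B - B') \<le> (q - 1) * y"
  shows "nrm ((A @\<^sub>r B) - C) \<le> ((1 + \<epsilon>) * q - 1) * (x + y)"
proof -
  let ?S = "A @\<^sub>r B" and ?T = "A' @\<^sub>r B'"
  have car: "?S \<in> carrier_mat (dim_row ?S) (dim_col ?S)" "?T \<in> carrier_mat (dim_row ?S) (dim_col ?S)"
    "C \<in> carrier_mat (dim_row ?S) (dim_col ?S)"
    using dims by auto
  have "nrm (?S - ?T) = nrm ((A - A') @\<^sub>r (B - B'))"
    using dims by (simp add: append_rows_minus)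
  also have "\<dots> \<le> nrm (A - A') + nrm (B - B')"
    using dims by (intro append) auto
  also have "\<dots> \<le> (q - 1) * (x + y)"
    using A B by (simp add: distrib_left)
  finally have ST: "nrm (?S - ?T) \<le> (q - 1) * (x + y)" .
  have "nrm ?S \<le> x + y"
    using append[of A B] A B dims by linarith
  then have T: "nrm ?T \<le> q * (x + y)"
    using le_diff_add[OF car(1,2)] ST by (simp add: algebra_simps)
  have "nrm (?S - C) \<le> nrm (?S - ?T) + nrm (C - ?T)"
    using diff_triangle[OF car(1,2,3)] minus_commute[OF car(2,3)] by simp
  also have "\<dots> \<le> (q - 1) * (x + y) + \<epsilon> * (q * (x + y))"
    using ST C mult_left_mono[OF T eps] by linarith
  finally show ?thesis by (simp add: algebra_simps)
qed

text \<open>Induction on the height \<open>k\<close> above the leaves: node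
  \<open>(L - k, b)\<close> covers the leaves from \<open>b * 2 ^ k\<close> up to but excluding
  \<open>(b + 1) * 2 ^ k\<close>, and \<open>blk k b\<close> stacks the exact blocks there.
  Dimensions and norm bounds are carried along because each agglomeration consumes them. The
  exponent is \<open>Suc k\<close> since a leaf has already been compressed once.\<close>

lemma node_error:
  fixes Hs :: "real mat list" and n :: nat
  defines "blk \<equiv> \<lambda>k b. stack n (map ((!) Hs) [b * 2 ^ k ..< (b + 1) * 2 ^ k])"
  assumes len: "length Hs = 2 ^ L" and cols: "\<And>B. B \<in> set Hs \<Longrightarrow> dim_col B = n"
    and eps: "0 \<le> \<epsilon>" and rec: "recursive_low_rank nrm \<epsilon> L Hs Hhat"
    and "k \<le> L" "b < 2 ^ (L - k)"
  shows "dim_col (blk k b) = n \<and>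
    Hhat (L - k) b \<in> carrier_mat (dim_row (blk k b)) n \<and>
    nrm (blk k b) \<le> (\<Sum>i = b * 2 ^ k ..< (b + 1) * 2 ^ k. nrm (Hs ! i)) \<and>
    nrm (blk k b - Hhat (L - k) b)
      \<le> ((1 + \<epsilon>) ^ Suc k - 1) * (\<Sum>i = b * 2 ^ k ..< (b + 1) * 2 ^ k. nrm (Hs ! i))"
  using \<open>k \<le> L\<close> \<open>b < 2 ^ (L - k)\<close>
proof (induction k arbitrary: b)
  case 0
  then have "dim_col (Hs ! b) = n" using cols len by simp
  moreover from this have "blk 0 b = Hs ! b"
    by (simp add: blk_def append_rows_empty)
  ultimately show ?case
    using 0 rec by (auto simp: recursive_low_rank_def)
next
  case (Suc k)
  \<comment> \<open>The level of the parent node; its children lie on level \<open>Suc l\<close>, at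
    height \<open>k\<close>.\<close>
  define l where "l = L - Suc k"
  have l: "L - k = Suc l" "l < L" using Suc.prems by (auto simp: l_def)
  have b: "b < 2 ^ l" using Suc.prems by (simp add: l_def)
  let ?x = "\<lambda>k b. \<Sum>i = b * 2 ^ k ..< (b + 1) * 2 ^ k. nrm (Hs ! i)"
  let ?A = "blk k (2 * b)" and ?B = "blk k (2 * b + 1)"
  let ?A' = "Hhat (Suc l) (2 * b)" and ?B' = "Hhat (Suc l) (2 * b + 1)"
  note IH = Suc.IH[of "2 * b", unfolded l(1)] Suc.IH[of "2 * b + 1", unfolded l(1)]
  have A: "dim_col ?A = n" "?A' \<in> carrier_mat (dim_row ?A) n" "nrm ?A \<le> ?x k (2 * b)"
      "nrm (?A - ?A') \<le> ((1 + \<epsilon>) ^ Suc k - 1) * ?x k (2 * b)"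
    and B: "dim_col ?B = n" "?B' \<in> carrier_mat (dim_row ?B) n" "nrm ?B \<le> ?x k (2 * b + 1)"
      "nrm (?B - ?B') \<le> ((1 + \<epsilon>) ^ Suc k - 1) * ?x k (2 * b + 1)"
    using IH Suc.prems b by simp_all
  \<comment> \<open>The leaves below a node are those of the left child followed by those of the
    right child; both the sum and the index list split at
    \<open>(2 * b + 1) * 2 ^ k\<close>.\<close>
  have idx: "b * 2 ^ Suc k = 2 * b * 2 ^ k" "(b + 1) * 2 ^ Suc k = (2 * b + 1 + 1) * 2 ^ k"
    "2 * b * 2 ^ k \<le> (2 * b + 1) * 2 ^ k" "(2 * b + 1) * 2 ^ k \<le> (2 * b + 1 + 1) * (2 ^ k :: nat)"
    by (auto simp: algebra_simps)
  have x: "?x (Suc k) b = ?x k (2 * b) + ?x k (2 * b + 1)"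
    unfolding idx(1,2) by (rule sum.atLeastLessThan_concat[symmetric, OF idx(3,4)])
  have upt: "[b * 2 ^ Suc k ..< (b + 1) * 2 ^ Suc k] =
      [2 * b * 2 ^ k ..< (2 * b + 1) * 2 ^ k] @ [(2 * b + 1) * 2 ^ k ..< (2 * b + 1 + 1) * 2 ^ k]"
    unfolding idx(1,2) using idx(3,4) by (metis le_iff_add upt_add_eq_append)
  \<comment> \<open>The right end of the interval does not exceed the length of \<open>Hs\<close>,
    so every listed block is a genuine member of \<open>Hs\<close> and has \<open>n\<close>
    columns.\<close>
  have "(b + 1) * 2 ^ Suc k \<le> 2 ^ l * 2 ^ Suc k"
    using b by (intro mult_right_mono) auto
  also have "\<dots> = 2 ^ L"
    using Suc.prems by (simp add: l_def flip: power_add power_Suc)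
  finally have "dim_col M = n" if "M \<in> set (map ((!) Hs) [b * 2 ^ Suc k ..< (b + 1) * 2 ^ Suc k])" for M
    using that len by (auto intro!: cols)
  then have blk: "blk (Suc k) b = ?A @\<^sub>r ?B"
    unfolding blk_def upt map_append by (rule stack_append)
  have C: "Hhat l b \<in> carrier_mat (dim_row (?A' @\<^sub>r ?B')) (dim_col (?A' @\<^sub>r ?B'))"
    "nrm (Hhat l b - (?A' @\<^sub>r ?B')) \<le> \<epsilon> * nrm (?A' @\<^sub>r ?B')"
    using rec l(2) b by (auto simp: recursive_low_rank_def Let_def)
  have "nrm ((?A @\<^sub>r ?B) - Hhat l b)
      \<le> ((1 + \<epsilon>) * (1 + \<epsilon>) ^ Suc k - 1) * (?x k (2 * b) + ?x k (2 * b + 1))"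
    by (rule agglomeration_error[of ?A ?B ?A' ?B']) (use A B C eps in simp_all)
  moreover have "nrm (?A @\<^sub>r ?B) \<le> ?x k (2 * b) + ?x k (2 * b + 1)"
    using append[of ?A ?B] A B by simp
  ultimately show ?case
    unfolding x blk l_def[symmetric] using A B C(1) by simp
qed

lemma output_error:
  assumes "length Hs = 2 ^ L" "row_partition H Hs" "0 \<le> \<epsilon>" "\<epsilon> \<le> 1"
    and "recursive_low_rank nrm \<epsilon> L Hs Hhat"
  shows "nrm (H - Hhat 0 0) \<le> (real L + 1) * \<epsilon> * (\<Sum>b<2 ^ L. nrm (Hs ! b))
      + 3 ^ Suc L * (2 ^ L * nrm H) * \<epsilon>\<^sup>2"
proof -
  let ?s = "\<Sum>b<2 ^ L. nrm (Hs ! b)"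
  have cols: "\<And>B. B \<in> set Hs \<Longrightarrow> dim_col B = dim_col H" and H: "H = stack (dim_col H) Hs"
    using assms(2) by (auto simp: row_partition_def)
  \<comment> \<open>At height \<open>L\<close> the node 0 covers all leaves, so its exact block is
    \<open>H\<close> itself.\<close>
  have "stack (dim_col H) (map ((!) Hs) [0 ..< 2 ^ L]) = H"
    using H assms(1) map_nth[of Hs] by simp
  with node_error[OF assms(1) cols assms(3,5), of L 0]
  have node: "nrm (H - Hhat 0 0) \<le> ((1 + \<epsilon>) ^ Suc L - 1) * ?s"
    by (simp_all add: atLeast0LessThan)
  \<comment> \<open>The first-order term keeps the sum of the block norms; only in the remainder is
    that sum replaced by a bound that depends on \<open>L\<close> and \<open>H\<close>
    alone.\<close>
  have "nrm (Hs ! b) \<le> nrm H" if "b < 2 ^ L" for b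
    using block_le_stack[OF cols, of Hs "Hs ! b"] assms(1) H that by simp
  then have "?s \<le> (\<Sum>b<2 ^ L::nat. nrm H)"
    by (intro sum_mono) simp
  then have s: "?s \<le> 2 ^ L * nrm H" by simp
  have "((1 + \<epsilon>) ^ Suc L - 1) * ?s \<le> (real (Suc L) * \<epsilon> + 3 ^ Suc L * \<epsilon>\<^sup>2) * ?s"
    by (intro mult_right_mono power_one_plus_le assms sum_nonneg nonneg)
  also have "\<dots> = (real L + 1) * \<epsilon> * ?s + 3 ^ Suc L * ?s * \<epsilon>\<^sup>2"
    by (simp add: algebra_simps)
  also have "\<dots> \<le> (real L + 1) * \<epsilon> * ?s + 3 ^ Suc L * (2 ^ L * nrm H) * \<epsilon>\<^sup>2"
    using s by (intro add_left_mono mult_right_mono mult_left_mono) auto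
  finally show "nrm (H - Hhat 0 0) \<le> (real L + 1) * \<epsilon> * ?s + 3 ^ Suc L * (2 ^ L * nrm H) * \<epsilon>\<^sup>2"
    using node by linarith
qed

end

section \<open>The Frobenius and spectral norms\<close>

lemma frobenius_norm_L2_set:
  "frobenius_norm A = L2_set (\<lambda>i. L2_set (\<lambda>j. A $$ (i, j)) {..<dim_col A}) {..<dim_row A}"
  by (simp add: frobenius_norm_def L2_set_def sum_nonneg)

text \<open>Reading the norm column by column serves the \<open>dim_col\<close> half of the
  comparison with the spectral norm.\<close>

lemma frobenius_norm_L2_set_col:
  "frobenius_norm A = L2_set (\<lambda>j. L2_set (\<lambda>i. A $$ (i, j)) {..<dim_row A}) {..<dim_col A}"
  unfolding frobenius_norm_def
  by (subst sum.swap) (simp add: L2_set_def sum_nonneg)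

lemma euclidean_norm_L2_set: "euclidean_norm v = L2_set (($) v) {..<dim_vec v}"
  by (simp add: euclidean_norm_def scalar_prod_def L2_set_def power2_eq_square atLeast0LessThan)

lemma euclidean_norm_nonneg: "0 \<le> euclidean_norm v"
  by (simp add: euclidean_norm_L2_set)

lemma euclidean_norm_add:
  assumes "v \<in> carrier_vec n" "w \<in> carrier_vec n"
  shows "euclidean_norm (v + w) \<le> euclidean_norm v + euclidean_norm w"
proof -
  have "euclidean_norm (v + w) = L2_set (\<lambda>i. v $ i + w $ i) {..<n}"
    unfolding euclidean_norm_L2_set by (rule L2_set_cong) (use assms in auto)
  then show ?thesis
    using L2_set_triangle_ineq[of "($) v" "($) w" "{..<n}"] assms
    by (simp add: euclidean_norm_L2_set)
qed

lemma euclidean_norm_smult: "euclidean_norm (c \<cdot>\<^sub>v v) = \<bar>c\<bar> * euclidean_norm v"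
  by (simp add: euclidean_norm_L2_set L2_set_def power_mult_distrib real_sqrt_mult
      flip: sum_distrib_left)

lemma euclidean_norm_append:
  "(euclidean_norm (v @\<^sub>v w))\<^sup>2 = (euclidean_norm v)\<^sup>2 + (euclidean_norm w)\<^sup>2"
proof -
  have "(v @\<^sub>v w) \<bullet> (v @\<^sub>v w) = v \<bullet> v + w \<bullet> w"
    by (rule scalar_prod_append[of _ "dim_vec v" _ "dim_vec w"]) auto
  then show ?thesis
    by (simp add: euclidean_norm_def sum_nonneg scalar_prod_def)
qed

text \<open>Cauchy-Schwarz in each row, then \<open>L2_set\<close> over the rows. This estimate
  makes the supremum in \<open>spectral_norm\<close> finite.\<close>

lemma euclidean_norm_mult_mat_vec_le:
  assumes "v \<in> carrier_vec (dim_col A)"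
  shows "euclidean_norm (A *\<^sub>v v) \<le> frobenius_norm A * euclidean_norm v"
proof -
  let ?r = "\<lambda>i. L2_set (\<lambda>j. A $$ (i, j)) {..<dim_col A}"
  have "\<bar>(A *\<^sub>v v) $ i\<bar> \<le> ?r i * euclidean_norm v" if "i < dim_row A" for i
  proof -
    have "\<bar>(A *\<^sub>v v) $ i\<bar> = \<bar>\<Sum>j<dim_col A. A $$ (i, j) * v $ j\<bar>"
      using that assms by (simp add: scalar_prod_def atLeast0LessThan)
    also have "\<dots> \<le> (\<Sum>j<dim_col A. \<bar>A $$ (i, j)\<bar> * \<bar>v $ j\<bar>)"
      by (rule order_trans[OF sum_abs]) (simp add: abs_mult)
    also have "\<dots> \<le> ?r i * euclidean_norm v"
      using L2_set_mult_ineq[of "\<lambda>j. A $$ (i, j)" "($) v" "{..<dim_col A}"] assms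
      by (simp add: euclidean_norm_L2_set)
    finally show ?thesis .
  qed
  then have "L2_set (\<lambda>i. \<bar>(A *\<^sub>v v) $ i\<bar>) {..<dim_row A}
      \<le> L2_set (\<lambda>i. ?r i * euclidean_norm v) {..<dim_row A}"
    by (intro L2_set_mono) auto
  also have "\<dots> = frobenius_norm A * euclidean_norm v"
    by (simp add: frobenius_norm_L2_set euclidean_norm_nonneg L2_set_left_distrib)
  finally show ?thesis
    by (simp add: euclidean_norm_L2_set[of "A *\<^sub>v v"] L2_set_def)
qed

section \<open>The Frobenius norm under stacking\<close>

lemma frobenius_norm_nonneg: "0 \<le> frobenius_norm A"
  by (simp add: frobenius_norm_L2_set)

lemma frobenius_norm_append:
  assumes "dim_col A = dim_col B"
  shows "(frobenius_norm (A @\<^sub>r B))\<^sup>2 = (frobenius_norm A)\<^sup>2 + (frobenius_norm B)\<^sup>2"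
proof -
  have split: "(\<Sum>i<a + b. f i) = (\<Sum>i<a. f i) + (\<Sum>i<b. f (a + i))"
    for f :: "nat \<Rightarrow> real" and a b
    by (induction b) auto
  show ?thesis
    using assms by (simp add: frobenius_norm_def sum_nonneg split index_append_rows)
qed

lemma frobenius_norm_stack:
  assumes "\<And>B. B \<in> set Bs \<Longrightarrow> dim_col B = n"
  shows "(frobenius_norm (stack n Bs))\<^sup>2 = (\<Sum>B\<leftarrow>Bs. (frobenius_norm B)\<^sup>2)"
  using assms
proof (induction Bs)
  case (Cons A Bs)
  have "dim_col (stack n Bs) = n" using Cons.prems by (intro dim_col_stack) auto
  with Cons show ?case by (simp add: frobenius_norm_append)
qed (simp add: frobenius_norm_def)

text \<open>Yields all three stacking laws once squared norms add: for Frobenius norms of matrices,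
  and for Euclidean norms of image vectors on the way to the spectral norm.\<close>

lemma pythagoras_bounds:
  fixes x y z :: real
  assumes "z\<^sup>2 = x\<^sup>2 + y\<^sup>2" "0 \<le> x" "0 \<le> y" "0 \<le> z"
  shows "x \<le> z" "y \<le> z" "z \<le> x + y"
proof -
  show "x \<le> z" "y \<le> z" using assms by (auto intro: power2_le_imp_le)
  show "z \<le> x + y" by (rule power2_le_imp_le) (use assms in \<open>auto simp: power2_sum\<close>)
qed

interpretation frobenius: stacking_norm frobenius_norm
proof
  fix A B :: "real mat"
  assume "dim_col A = dim_col B"
  note * = pythagoras_bounds[OF frobenius_norm_append[OF this]
      frobenius_norm_nonneg frobenius_norm_nonneg frobenius_norm_nonneg]
  show "frobenius_norm (A @\<^sub>r B) \<le> frobenius_norm A + frobenius_norm B"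
    "frobenius_norm A \<le> frobenius_norm (A @\<^sub>r B)" "frobenius_norm B \<le> frobenius_norm (A @\<^sub>r B)"
    by (fact *)+
next
  fix A B :: "real mat" and m n
  assume AB: "A \<in> carrier_mat m n" "B \<in> carrier_mat m n"
  \<comment> \<open>A matrix is read as a function on index pairs, so that the triangle inequality
    becomes the one for \<open>L2_set\<close> over a rectangle.\<close>
  have L2: "frobenius_norm X = L2_set (($$) X) ({..<m} \<times> {..<n})"
    if "X \<in> carrier_mat m n" for X :: "real mat"
    using that by (auto simp: frobenius_norm_def L2_set_def sum.cartesian_product)
  have "L2_set (($$) (A + B)) ({..<m} \<times> {..<n})
      = L2_set (\<lambda>p. A $$ p + B $$ p) ({..<m} \<times> {..<n})"
    using AB by (intro L2_set_cong) auto
  then show "frobenius_norm (A + B) \<le> frobenius_norm A + frobenius_norm B"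
    using AB L2_set_triangle_ineq[of "($$) A" "($$) B"] by (simp add: L2)
  show "frobenius_norm (A - B) = frobenius_norm (B - A)"
    using AB by (simp add: frobenius_norm_def power2_commute)
qed (fact frobenius_norm_nonneg)

section \<open>The spectral norm as a supremum over the unit ball\<close>

text \<open>A real supremum dominates its members only if they are bounded above; on the unit ball
  the Frobenius norm is such a bound.\<close>

lemma euclidean_norm_le_spectral_norm:
  assumes "v \<in> carrier_vec (dim_col A)" "euclidean_norm v \<le> 1"
  shows "euclidean_norm (A *\<^sub>v v) \<le> spectral_norm A"
  unfolding spectral_norm_def
proof (rule cSUP_upper)
  show "bdd_above ((\<lambda>v. euclidean_norm (A *\<^sub>v v)) `
      {v \<in> carrier_vec (dim_col A). euclidean_norm v \<le> 1})"
  proof (rule bdd_aboveI2)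
    fix v assume "v \<in> {v \<in> carrier_vec (dim_col A). euclidean_norm v \<le> 1}"
    then show "euclidean_norm (A *\<^sub>v v) \<le> frobenius_norm A"
      using euclidean_norm_mult_mat_vec_le[of v A] frobenius_norm_nonneg[of A]
        mult_left_le[of "euclidean_norm v" "frobenius_norm A"] by auto
  qed
qed (use assms in simp)

lemma spectral_norm_le:
  assumes "\<And>v. v \<in> carrier_vec (dim_col A) \<Longrightarrow> euclidean_norm v \<le> 1 \<Longrightarrow>
    euclidean_norm (A *\<^sub>v v) \<le> c"
  shows "spectral_norm A \<le> c"
  unfolding spectral_norm_def
proof (rule cSUP_least)
  \<comment> \<open>The zero vector lies in the ball even when \<open>A\<close> has no
    columns.\<close>
  have "0\<^sub>v (dim_col A) \<in> {v \<in> carrier_vec (dim_col A). euclidean_norm v \<le> 1}"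
    by (simp add: euclidean_norm_def)
  then show "{v \<in> carrier_vec (dim_col A). euclidean_norm v \<le> 1} \<noteq> {}" by blast
qed (use assms in simp)

lemma spectral_norm_nonneg: "0 \<le> spectral_norm A"
proof -
  have "euclidean_norm (0\<^sub>v (dim_col A)) \<le> 1" by (simp add: euclidean_norm_def)
  then show ?thesis
    using euclidean_norm_le_spectral_norm[of "0\<^sub>v (dim_col A)" A]
      euclidean_norm_nonneg[of "A *\<^sub>v 0\<^sub>v (dim_col A)"] by simp
qed

lemma euclidean_norm_mult_mat_vec_le_spectral:
  assumes "v \<in> carrier_vec (dim_col A)"
  shows "euclidean_norm (A *\<^sub>v v) \<le> spectral_norm A * euclidean_norm v"
proof (cases "euclidean_norm v = 0")
  case True
  \<comment> \<open>Such a vector cannot be normalised, but the Frobenius estimate forces its image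
    to have norm 0.\<close>
  then show ?thesis using euclidean_norm_mult_mat_vec_le[OF assms] by simp
next
  case False
  define c where "c = euclidean_norm v"
  have c: "c > 0" using False euclidean_norm_nonneg[of v] by (simp add: c_def)
  have "A *\<^sub>v ((1 / c) \<cdot>\<^sub>v v) = (1 / c) \<cdot>\<^sub>v (A *\<^sub>v v)"
    using assms by (intro mult_mat_vec) auto
  then have "(1 / c) * euclidean_norm (A *\<^sub>v v) \<le> spectral_norm A"
    using euclidean_norm_le_spectral_norm[of "(1 / c) \<cdot>\<^sub>v v" A] assms c
    by (simp add: euclidean_norm_smult flip: c_def)
  then show ?thesis using c by (simp add: field_simps flip: c_def)
qed

lemma spectral_norm_le_frobenius_norm: "spectral_norm A \<le> frobenius_norm A"
  using euclidean_norm_mult_mat_vec_le[of _ A] frobenius_norm_nonneg[of A]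
  by (intro spectral_norm_le) (meson mult_left_le order_trans)

text \<open>The stacked matrix maps \<open>v\<close> to the concatenation of the two images, so
  Pythagoras gives the stacking laws for each \<open>v\<close>, and they pass to the
  suprema.\<close>

interpretation spectral: stacking_norm spectral_norm
proof
  fix A B :: "real mat"
  assume cols: "dim_col A = dim_col B"
  have *: "euclidean_norm (A *\<^sub>v v) \<le> euclidean_norm ((A @\<^sub>r B) *\<^sub>v v)"
      "euclidean_norm (B *\<^sub>v v) \<le> euclidean_norm ((A @\<^sub>r B) *\<^sub>v v)"
      "euclidean_norm ((A @\<^sub>r B) *\<^sub>v v) \<le> euclidean_norm (A *\<^sub>v v) + euclidean_norm (B *\<^sub>v v)"
    if "v \<in> carrier_vec (dim_col A)" for v
  proof -
    have "(A @\<^sub>r B) *\<^sub>v v = (A *\<^sub>v v) @\<^sub>v (B *\<^sub>v v)"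
      by (rule mat_mult_append[OF _ _ that]) (use cols in auto)
    then show "euclidean_norm (A *\<^sub>v v) \<le> euclidean_norm ((A @\<^sub>r B) *\<^sub>v v)"
      "euclidean_norm (B *\<^sub>v v) \<le> euclidean_norm ((A @\<^sub>r B) *\<^sub>v v)"
      "euclidean_norm ((A @\<^sub>r B) *\<^sub>v v) \<le> euclidean_norm (A *\<^sub>v v) + euclidean_norm (B *\<^sub>v v)"
      using pythagoras_bounds[OF euclidean_norm_append euclidean_norm_nonneg
          euclidean_norm_nonneg euclidean_norm_nonneg] by simp_all
  qed
  show "spectral_norm (A @\<^sub>r B) \<le> spectral_norm A + spectral_norm B"
  proof (rule spectral_norm_le)
    fix v assume "v \<in> carrier_vec (dim_col (A @\<^sub>r B))" "euclidean_norm v \<le> 1"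
    then show "euclidean_norm ((A @\<^sub>r B) *\<^sub>v v) \<le> spectral_norm A + spectral_norm B"
      using *(3)[of v] euclidean_norm_le_spectral_norm[of v A]
        euclidean_norm_le_spectral_norm[of v B] cols by simp
  qed
  show "spectral_norm A \<le> spectral_norm (A @\<^sub>r B)"
  proof (rule spectral_norm_le)
    fix v assume "v \<in> carrier_vec (dim_col A)" "euclidean_norm v \<le> 1"
    then show "euclidean_norm (A *\<^sub>v v) \<le> spectral_norm (A @\<^sub>r B)"
      using *(1)[of v] euclidean_norm_le_spectral_norm[of v "A @\<^sub>r B"] by simp
  qed
  show "spectral_norm B \<le> spectral_norm (A @\<^sub>r B)"
  proof (rule spectral_norm_le)
    fix v assume "v \<in> carrier_vec (dim_col B)" "euclidean_norm v \<le> 1"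
    then show "euclidean_norm (B *\<^sub>v v) \<le> spectral_norm (A @\<^sub>r B)"
      using *(2)[of v] euclidean_norm_le_spectral_norm[of v "A @\<^sub>r B"] cols by simp
  qed
next
  fix A B :: "real mat" and m n
  assume AB: "A \<in> carrier_mat m n" "B \<in> carrier_mat m n"
  show "spectral_norm (A + B) \<le> spectral_norm A + spectral_norm B"
  proof (rule spectral_norm_le)
    fix v assume v: "v \<in> carrier_vec (dim_col (A + B))" "euclidean_norm v \<le> 1"
    then have "(A + B) *\<^sub>v v = A *\<^sub>v v + B *\<^sub>v v"
      using AB by (intro add_mult_distrib_mat_vec) auto
    moreover have "euclidean_norm (A *\<^sub>v v + B *\<^sub>v v) \<le> euclidean_norm (A *\<^sub>v v) + euclidean_norm (B *\<^sub>v v)"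
      by (rule euclidean_norm_add[of _ m]) (use AB v in \<open>auto intro!: mult_mat_vec_carrier\<close>)
    ultimately show "euclidean_norm ((A + B) *\<^sub>v v) \<le> spectral_norm A + spectral_norm B"
      using euclidean_norm_le_spectral_norm[of v A] euclidean_norm_le_spectral_norm[of v B] AB v
      by simp
  qed
  \<comment> \<open>Stated for arbitrary matrices of this size, so that exchanging them gives the
    reverse inequality.\<close>
  have "spectral_norm (A - B) \<le> spectral_norm (B - A)"
    if "A \<in> carrier_mat m n" "B \<in> carrier_mat m n" for A B :: "real mat"
  proof (rule spectral_norm_le)
    fix v assume v: "v \<in> carrier_vec (dim_col (A - B))" "euclidean_norm v \<le> 1"
    have "(A - B) *\<^sub>v v = (-1) \<cdot>\<^sub>v ((B - A) *\<^sub>v v)"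
      using that v by (auto simp: minus_mult_distrib_mat_vec)
    then have "euclidean_norm ((A - B) *\<^sub>v v) = euclidean_norm ((B - A) *\<^sub>v v)"
      by (simp only: euclidean_norm_smult)
    then show "euclidean_norm ((A - B) *\<^sub>v v) \<le> spectral_norm (B - A)"
      using euclidean_norm_le_spectral_norm[of v "B - A"] that v by simp
  qed
  then show "spectral_norm (A - B) = spectral_norm (B - A)"
    using AB by (intro antisym) auto
qed (fact spectral_norm_nonneg)

section \<open>Comparison of the Frobenius and spectral norms\<close>

text \<open>Column \<open>j\<close> is the image of the \<open>j\<close>-th unit vector.\<close>

lemma col_norm_le_spectral_norm:
  assumes "j < dim_col A"
  shows "L2_set (\<lambda>i. A $$ (i, j)) {..<dim_row A} \<le> spectral_norm A"
proof -
  have "A *\<^sub>v unit_vec (dim_col A) j = col A j"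
    using assms by (intro eq_vecI) auto
  moreover have "euclidean_norm (unit_vec (dim_col A) j) = 1"
    using assms by (simp add: euclidean_norm_def)
  ultimately have "euclidean_norm (col A j) \<le> spectral_norm A"
    using euclidean_norm_le_spectral_norm[of "unit_vec (dim_col A) j" A] by simp
  then show ?thesis
    using assms by (simp add: euclidean_norm_L2_set L2_set_def)
qed

text \<open>Test \<open>A\<close> on its own row \<open>r\<close>: the squared norm of
  \<open>r\<close> is entry \<open>i\<close> of the image of \<open>r\<close>, hence at most
  \<open>spectral_norm A\<close> times the norm of \<open>r\<close>. That norm is then cancelled,
  with a zero row treated separately.\<close>

lemma row_norm_le_spectral_norm:
  assumes "i < dim_row A"
  shows "L2_set (\<lambda>j. A $$ (i, j)) {..<dim_col A} \<le> spectral_norm A"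
proof -
  let ?r = "row A i"
  have "(euclidean_norm ?r)\<^sup>2 = (A *\<^sub>v ?r) $ i"
    using assms by (simp add: euclidean_norm_def scalar_prod_def sum_nonneg)
  also have "\<dots> \<le> euclidean_norm (A *\<^sub>v ?r)"
    unfolding euclidean_norm_L2_set by (rule member_le_L2_set) (use assms in auto)
  also have "\<dots> \<le> spectral_norm A * euclidean_norm ?r"
    by (rule euclidean_norm_mult_mat_vec_le_spectral) auto
  finally have "euclidean_norm ?r \<le> spectral_norm A"
    using euclidean_norm_nonneg[of ?r] spectral_norm_nonneg[of A]
    by (cases "euclidean_norm ?r = 0") (auto simp: power2_eq_square)
  then show ?thesis
    using assms by (simp add: euclidean_norm_L2_set L2_set_def)
qed

text \<open>Each row, and likewise each column, has norm at most \<open>spectral_norm A\<close>.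
  Counting rows and counting columns are both valid, so the smaller count may be taken.\<close>

lemma frobenius_norm_le_spectral_norm:
  "frobenius_norm A \<le> sqrt (real (min (dim_row A) (dim_col A))) * spectral_norm A"
proof -
  have bound: "L2_set f {..<n} \<le> sqrt (real n) * spectral_norm A"
    if "\<And>i. i < n \<Longrightarrow> 0 \<le> f i \<and> f i \<le> spectral_norm A" for f and n :: nat
  proof -
    have "L2_set f {..<n} \<le> L2_set (\<lambda>_. spectral_norm A) {..<n}"
      using that by (intro L2_set_mono) auto
    then show ?thesis by (simp add: L2_set_constant spectral_norm_nonneg)
  qed
  have "frobenius_norm A \<le> sqrt (real (dim_row A)) * spectral_norm A"
    unfolding frobenius_norm_L2_set by (intro bound) (simp add: row_norm_le_spectral_norm)
  moreover have "frobenius_norm A \<le> sqrt (real (dim_col A)) * spectral_norm A"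
    unfolding frobenius_norm_L2_set_col by (intro bound) (simp add: col_norm_le_spectral_norm)
  ultimately show ?thesis by (simp add: min_def)
qed

section \<open>From block norms to the norm of the whole matrix\<close>

text \<open>Cauchy-Schwarz against the constant 1 on \<open>2 ^ L\<close> blocks gives the factor
  \<open>sqrt (2 ^ L)\<close>; the squared block norms add up exactly to that of
  \<open>H\<close>.\<close>

lemma sum_frobenius_norm_blocks_le:
  assumes "length Hs = 2 ^ L" "row_partition H Hs"
  shows "(\<Sum>b<2 ^ L. frobenius_norm (Hs ! b)) \<le> 2 powr (real L / 2) * frobenius_norm H"
proof -
  have "(frobenius_norm H)\<^sup>2 = (\<Sum>B\<leftarrow>Hs. (frobenius_norm B)\<^sup>2)"
    using assms(2) frobenius_norm_stack[of Hs "dim_col H"] by (simp add: row_partition_def)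
  also have "\<dots> = (\<Sum>b<2 ^ L. (frobenius_norm (Hs ! b))\<^sup>2)"
    using assms(1) by (simp add: sum_list_sum_nth atLeast0LessThan)
  finally have H: "L2_set (\<lambda>b. frobenius_norm (Hs ! b)) {..<2 ^ L} = frobenius_norm H"
    by (simp add: L2_set_def frobenius_norm_nonneg real_sqrt_unique)
  have pow: "2 powr (real L / 2) = sqrt (2 ^ L)"
    by (simp add: powr_half_sqrt[symmetric] powr_powr flip: powr_realpow)
  have "(\<Sum>b<2 ^ L. frobenius_norm (Hs ! b))
      \<le> L2_set (\<lambda>_. 1) {..<2 ^ L :: nat} * L2_set (\<lambda>b. frobenius_norm (Hs ! b)) {..<2 ^ L}"
    using L2_set_mult_ineq[of "\<lambda>_. 1" "\<lambda>b. frobenius_norm (Hs ! b)" "{..<2 ^ L}"]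
    by (simp add: frobenius_norm_nonneg)
  then show ?thesis by (simp add: H pow L2_set_constant)
qed

lemma frobenius_output_error:
  assumes "length Hs = 2 ^ L" "row_partition H Hs" "0 \<le> \<epsilon>" "\<epsilon> \<le> 1"
    and "recursive_low_rank frobenius_norm \<epsilon> L Hs Hhat"
  shows "frobenius_norm (H - Hhat 0 0)
    \<le> 2 powr (real L / 2) * (real L + 1) * \<epsilon> * frobenius_norm H
      + 3 ^ Suc L * (2 ^ L * frobenius_norm H) * \<epsilon>\<^sup>2"
proof -
  have "(real L + 1) * \<epsilon> * (\<Sum>b<2 ^ L. frobenius_norm (Hs ! b))
      \<le> (real L + 1) * \<epsilon> * (2 powr (real L / 2) * frobenius_norm H)"
    using assms by (intro mult_left_mono sum_frobenius_norm_blocks_le) auto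
  with frobenius.output_error[OF assms] show ?thesis
    by (simp add: mult_ac)
qed

theorem mainTheorem2:
  fixes L M N :: nat and H :: "real mat"
  assumes "L \<ge> 1" and "H \<in> carrier_mat M N"
  shows
    "(\<forall>nrm \<in> {spectral_norm, frobenius_norm}.
        \<exists>C :: real. \<forall>Hs. length Hs = 2 ^ L \<and> row_partition H Hs \<longrightarrow>
          (\<forall>\<epsilon> :: real. 0 < \<epsilon> \<and> \<epsilon> \<le> 1 \<longrightarrow>
            (\<forall>Hhat. recursive_low_rank nrm \<epsilon> L Hs Hhat \<longrightarrow>
              nrm (H - Hhat 0 0)
                \<le> (real L + 1) * \<epsilon> * (\<Sum>b<2 ^ L. nrm (Hs ! b)) + C * \<epsilon>\<^sup>2)))
     \<and>
     (\<exists>C :: real. \<forall>Hs. length Hs = 2 ^ L \<and> row_partition H Hs \<longrightarrow>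
        (\<forall>\<epsilon> :: real. 0 < \<epsilon> \<and> \<epsilon> \<le> 1 \<longrightarrow>
          (\<forall>Hhat. recursive_low_rank frobenius_norm \<epsilon> L Hs Hhat \<longrightarrow>
            frobenius_norm (H - Hhat 0 0)
              \<le> 2 powr (real L / 2) * (real L + 1) * \<epsilon> * frobenius_norm H + C * \<epsilon>\<^sup>2)))
     \<and>
     (\<exists>C :: real. \<forall>Hs. length Hs = 2 ^ L \<and> row_partition H Hs \<longrightarrow>
        (\<forall>\<epsilon> :: real. 0 < \<epsilon> \<and> \<epsilon> \<le> 1 \<longrightarrow>
          (\<forall>Hhat. recursive_low_rank frobenius_norm \<epsilon> L Hs Hhat \<longrightarrow>
            spectral_norm (H - Hhat 0 0)
              \<le> sqrt (real (min M N)) * 2 powr (real L / 2) * (real L + 1) * \<epsilon> * spectral_norm H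
                + C * \<epsilon>\<^sup>2)))"
proof (intro conjI ballI exI allI impI)
  fix nrm Hs \<epsilon> Hhat
  assume "nrm \<in> {spectral_norm, frobenius_norm}"
    and Hs: "length Hs = 2 ^ L \<and> row_partition H Hs" and \<epsilon>: "0 < \<epsilon> \<and> \<epsilon> \<le> 1"
    and rec: "recursive_low_rank nrm \<epsilon> L Hs Hhat"
  then interpret stacking_norm nrm
    using spectral.stacking_norm_axioms frobenius.stacking_norm_axioms by blast
  \<comment> \<open>The remainder coefficient is the witness for \<open>C\<close>. It involves only
    \<open>L\<close>, \<open>H\<close> and the norm, not the partition, \<epsilon> or the choices in
    \<open>Hhat\<close>.\<close>
  show "nrm (H - Hhat 0 0) \<le> (real L + 1) * \<epsilon> * (\<Sum>b<2 ^ L. nrm (Hs ! b))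
      + 3 ^ Suc L * (2 ^ L * nrm H) * \<epsilon>\<^sup>2"
    using output_error[of Hs L H \<epsilon> Hhat] Hs \<epsilon> rec by simp
next
  fix Hs \<epsilon> Hhat
  assume Hs: "length Hs = 2 ^ L \<and> row_partition H Hs" and \<epsilon>: "0 < \<epsilon> \<and> \<epsilon> \<le> 1"
    and rec: "recursive_low_rank frobenius_norm \<epsilon> L Hs Hhat"
  have F: "frobenius_norm (H - Hhat 0 0)
    \<le> 2 powr (real L / 2) * (real L + 1) * \<epsilon> * frobenius_norm H
      + 3 ^ Suc L * (2 ^ L * frobenius_norm H) * \<epsilon>\<^sup>2"
    using frobenius_output_error[of Hs L H \<epsilon> Hhat] Hs \<epsilon> rec by simp
  show "frobenius_norm (H - Hhat 0 0)
    \<le> 2 powr (real L / 2) * (real L + 1) * \<epsilon> * frobenius_norm H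
      + 3 ^ Suc L * (2 ^ L * frobenius_norm H) * \<epsilon>\<^sup>2" by (fact F)
  have "frobenius_norm H \<le> sqrt (real (min M N)) * spectral_norm H"
    using frobenius_norm_le_spectral_norm[of H] assms(2) by simp
  then have "2 powr (real L / 2) * (real L + 1) * \<epsilon> * frobenius_norm H
      \<le> 2 powr (real L / 2) * (real L + 1) * \<epsilon> * (sqrt (real (min M N)) * spectral_norm H)"
    using \<epsilon> by (intro mult_left_mono) auto
  \<comment> \<open>The error passes from the spectral to the Frobenius norm for free; returning to
    the spectral norm of \<open>H\<close> costs the square root, in the linear term only. The
    remainder keeps its Frobenius constant, which depends only on \<open>L\<close> and
    \<open>H\<close>.\<close>
  with F spectral_norm_le_frobenius_norm[of "H - Hhat 0 0"]
  show "spectral_norm (H - Hhat 0 0)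
    \<le> sqrt (real (min M N)) * 2 powr (real L / 2) * (real L + 1) * \<epsilon> * spectral_norm H
      + 3 ^ Suc L * (2 ^ L * frobenius_norm H) * \<epsilon>\<^sup>2"
    by (simp add: mult_ac)
qed

end
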